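(* Let $1\le p<\infty$ and $\frac1p+\frac1q=1$. Then $$\big(l^p(\mathcal U)\big)'=l^q(\mathcal V)\quad\text{and}\quad\big(l^p(\mathcal V)\big)'=l^q(\mathcal U),$$ where $'$ denotes the Banach space dual and the identifications are made through the bilinear pairing $(\sigma_1,\sigma_2)=\sum_{\xi\in I}\sigma_1(\xi)\sigma_2(\xi)$; that is, $\sigma_2\mapsto(\,\cdot\,,\sigma_2)$ is an isomorphism of Banach spaces from $l^q(\mathcal V)$ onto $(l^p(\mathcal U))'$ and from $l^q(\mathcal U)$ onto $(l^p(\mathcal V))'$.
   Context: $\mathcal H$ is a separable complex Hilbert space with inner product $(\cdot,\cdot)_{\mathcal H}$. $I$ is a discrete (countable) index set. $\mathcal U=\{u_\xi\}_{\xi\in I}$ is a Riesz basis of $\mathcal H$, and $\mathcal V=\{v_\xi\}_{\xi\in I}\subset\mathcal H$ is the system biorthogonal to $\mathcal U$: $(u_\xi,v_\eta)_{\mathcal H}=\delta_{\xi\eta}$; then $\mathcal V$ is also a Riesz basis of $\mathcal H$. Standing assumptions on $\mathcal H^p$: $\{\mathcal H^p\}_{1\le p\le\infty}$ is a family of Banach spaces with norms $\|\cdot\|_{\mathcal H^p}$ such that $\mathcal H^p\subseteq\mathcal H$, $\mathcal H^2=\mathcal H$, and $|(x,y)_{\mathcal H}|\le\|x\|_{\mathcal H^p}\|y\|_{\mathcal H^q}$ for all $x\in\mathcal H^p$, $y\in\mathcal H^q$, $1\le p\le\infty$, $\frac1p+\frac1q=1$. They satisfy the real interpolation properties (equality of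 spaces with equivalent norms) $(\mathcal H^1,\mathcal H^2)_{\theta,p}=\mathcal H^p$ for $0<\theta<1$, $\frac1p=1-\frac\theta2$, and $(\mathcal H^2,\mathcal H^\infty)_{\theta,p}=\mathcal H^p$ for $0<\theta<1$, $\frac1p=\frac{1-\theta}2$. Also $\mathcal U\subset\mathcal H^p$ and $\mathcal V\subset\mathcal H^p$ for all $p\in[1,\infty]$. Spaces $l^p(\mathcal U)$: all $a:I\to\mathbb C$ with finite norm $$\|a\|_{l^p(\mathcal U)}=\Big(\sum_{\xi\in I}|a(\xi)|^p\|u_\xi\|_{\mathcal H^\infty}^{2-p}\Big)^{1/p}\ (1\le p\le2),\qquad \|a\|_{l^p(\mathcal U)}=\Big(\sum_{\xi\in I}|a(\xi)|^p\|v_\xi\|_{\mathcal H^\infty}^{2-p}\Big)^{1/p}\ (2\le p<\infty),$$ $\|a\|_{l^\infty(\mathcal U)}=\sup_{\xi\in I}|a(\xi)|\,\|v_\xi\|_{\mathcal H^\infty}^{-1}$. Spaces $l^p(\mathcal V)$ are defined by the same formulas with the roles of $u_\xi$ and $v_\xi$ interchanged: weight $\|v_\xi\|_{\mathcal H^\infty}^{2-p}$ for $1\le p\le2$, weight $\|u_\xi\|_{\mathcal H^\infty}^{2-p}$ for $2\le p<\infty$, and $\|b\|_{l^\infty(\mathcal V)}=\sup_{\xi\in I}|b(\xi)|\,\|u_\xi\|_{\mathcal H^\infty}^{-1}$. *)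

theory Defs
  imports "HOL-Analysis.Analysis" "HOL-Library.Function_Algebras"
begin

section \<open>Complex Hilbert spaces\<close>

text \<open>The inner product is linear in the first argument. Norm, topology and completeness are the
  ones of the underlying real inner product space.\<close>

class complex_hilbert_space = real_inner + complete_space +
  fixes scaleC :: "complex \<Rightarrow> 'a \<Rightarrow> 'a"
    and cinner :: "'a \<Rightarrow> 'a \<Rightarrow> complex"
  assumes scaleC_add_right: "scaleC c (x + y) = scaleC c x + scaleC c y"
    and scaleC_add_left: "scaleC (c + d) x = scaleC c x + scaleC d x"
    and scaleC_scaleC: "scaleC c (scaleC d x) = scaleC (c * d) x"
    and scaleC_of_real: "scaleC (complex_of_real r) x = scaleR r x"
    and cinner_commute: "cinner x y = cnj (cinner y x)"
    and cinner_add_left: "cinner (x + y) z = cinner x z + cinner y z"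
    and cinner_scaleC_left: "cinner (scaleC c x) y = c * cinner x y"
    and Re_cinner: "Re (cinner x y) = inner x y"

lemma vector_space_scaleC:
  "vector_space (scaleC :: complex \<Rightarrow> 'a \<Rightarrow> 'a::complex_hilbert_space)"
proof
  show "scaleC 1 x = x" for x :: 'a
    using scaleC_of_real[of 1 x] by simp
qed (simp_all add: scaleC_add_right scaleC_add_left scaleC_scaleC)

global_interpretation complex_vector:
  vector_space "scaleC :: complex \<Rightarrow> 'a \<Rightarrow> 'a::complex_hilbert_space"
  by (rule vector_space_scaleC)

definition orthonormal_basis :: "('i \<Rightarrow> 'h::complex_hilbert_space) \<Rightarrow> bool" where
  "orthonormal_basis e \<longleftrightarrow>
     (\<forall>\<xi> \<eta>. cinner (e \<xi>) (e \<eta>) = (if \<xi> = \<eta> then 1 else 0)) \<and>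
     closure (complex_vector.span (range e)) = UNIV"

text \<open>A Riesz basis is the image of an orthonormal basis under a bounded bijective operator;
  boundedness of the inverse is automatic.\<close>

definition riesz_basis :: "('i \<Rightarrow> 'h::complex_hilbert_space) \<Rightarrow> bool" where
  "riesz_basis u \<longleftrightarrow>
     (\<exists>(e :: 'i \<Rightarrow> 'h) (T :: 'h \<Rightarrow> 'h). orthonormal_basis e \<and> bounded_linear T \<and> (\<forall>c x. T (scaleC c x) = scaleC c (T x)) \<and>
        bij T \<and> (\<forall>\<xi>. u \<xi> = T (e \<xi>)))"

definition biorthogonal :: "('i \<Rightarrow> 'h::complex_hilbert_space) \<Rightarrow> ('i \<Rightarrow> 'h) \<Rightarrow> bool" where
  "biorthogonal u v \<longleftrightarrow> (\<forall>\<xi> \<eta>. cinner (u \<xi>) (v \<eta>) = (if \<xi> = \<eta> then 1 else 0))"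

section \<open>Complex Banach spaces on a carrier\<close>

text \<open>A Banach space is a subspace \<open>X\<close> of an ambient complex vector space, complete for a norm
  \<open>N\<close> whose values outside \<open>X\<close> are irrelevant.\<close>

locale complex_banach_space = vector_space s
  for s :: "complex \<Rightarrow> 'v::ab_group_add \<Rightarrow> 'v" +
  fixes X :: "'v set" and N :: "'v \<Rightarrow> real"
  assumes subspace_X: "subspace X"
    and N_nonneg: "x \<in> X \<Longrightarrow> 0 \<le> N x"
    and N_eq_0_iff: "x \<in> X \<Longrightarrow> N x = 0 \<longleftrightarrow> x = 0"
    and N_scale: "x \<in> X \<Longrightarrow> N (s c x) = cmod c * N x"
    and N_triangle: "x \<in> X \<Longrightarrow> y \<in> X \<Longrightarrow> N (x + y) \<le> N x + N y"
    and N_complete: "(\<And>n. f n \<in> X) \<Longrightarrow>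
          (\<And>e. 0 < e \<Longrightarrow> \<exists>M::nat. \<forall>m\<ge>M. \<forall>n\<ge>M. N (f m - f n) < e) \<Longrightarrow>
          \<exists>l\<in>X. (\<lambda>n. N (f n - l)) \<longlonglongrightarrow> 0"

definition banach_isomorphism ::
  "(complex \<Rightarrow> 'v::ab_group_add \<Rightarrow> 'v) \<Rightarrow> 'v set \<Rightarrow> ('v \<Rightarrow> real) \<Rightarrow>
   (complex \<Rightarrow> 'w::ab_group_add \<Rightarrow> 'w) \<Rightarrow> 'w set \<Rightarrow> ('w \<Rightarrow> real) \<Rightarrow> ('v \<Rightarrow> 'w) \<Rightarrow> bool" where
  "banach_isomorphism s X N s' Y M T \<longleftrightarrow>
     complex_banach_space s X N \<and> complex_banach_space s' Y M \<and>
     (\<forall>x\<in>X. \<forall>y\<in>X. T (x + y) = T x + T y) \<and>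
     (\<forall>c. \<forall>x\<in>X. T (s c x) = s' c (T x)) \<and>
     bij_betw T X Y \<and>
     (\<exists>C. \<forall>x\<in>X. M (T x) \<le> C * N x) \<and>
     (\<exists>C. \<forall>x\<in>X. N x \<le> C * M (T x))"

definition fun_scale :: "complex \<Rightarrow> ('x \<Rightarrow> complex) \<Rightarrow> 'x \<Rightarrow> complex" where
  "fun_scale c f = (\<lambda>x. c * f x)"

text \<open>Functionals on \<open>X\<close> are represented by functions vanishing outside \<open>X\<close>, so that they are
  determined by their values on \<open>X\<close> and the vector operations are pointwise.\<close>

definition dual_space ::
  "(complex \<Rightarrow> 'v::ab_group_add \<Rightarrow> 'v) \<Rightarrow> 'v set \<Rightarrow> ('v \<Rightarrow> real) \<Rightarrow> ('v \<Rightarrow> complex) set" where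
  "dual_space s X N = {\<phi>.
     (\<forall>x. x \<notin> X \<longrightarrow> \<phi> x = 0) \<and>
     (\<forall>x\<in>X. \<forall>y\<in>X. \<phi> (x + y) = \<phi> x + \<phi> y) \<and>
     (\<forall>c. \<forall>x\<in>X. \<phi> (s c x) = c * \<phi> x) \<and>
     (\<exists>C. \<forall>x\<in>X. cmod (\<phi> x) \<le> C * N x)}"

definition dual_norm :: "'v set \<Rightarrow> ('v \<Rightarrow> real) \<Rightarrow> ('v \<Rightarrow> complex) \<Rightarrow> real" where
  "dual_norm X N \<phi> = (SUP x\<in>{x\<in>X. N x \<le> 1}. cmod (\<phi> x))"

section \<open>Real interpolation (K-method)\<close>

definition K_functional ::
  "'v::ab_group_add set \<Rightarrow> ('v \<Rightarrow> real) \<Rightarrow> 'v set \<Rightarrow> ('v \<Rightarrow> real) \<Rightarrow> real \<Rightarrow> 'v \<Rightarrow> real" where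
  "K_functional X0 N0 X1 N1 t x =
     Inf {N0 x0 + t * N1 x1 | x0 x1. x0 \<in> X0 \<and> x1 \<in> X1 \<and> x = x0 + x1}"

definition interp_integral ::
  "'v::ab_group_add set \<Rightarrow> ('v \<Rightarrow> real) \<Rightarrow> 'v set \<Rightarrow> ('v \<Rightarrow> real) \<Rightarrow> real \<Rightarrow> real \<Rightarrow> 'v \<Rightarrow> ennreal" where
  "interp_integral X0 N0 X1 N1 \<theta> r x =
     (\<integral>\<^sup>+t\<in>{0<..}. ennreal ((t powr (-\<theta>) * K_functional X0 N0 X1 N1 t x) powr r / t) \<partial>lborel)"

definition interp_space ::
  "'v::ab_group_add set \<Rightarrow> ('v \<Rightarrow> real) \<Rightarrow> 'v set \<Rightarrow> ('v \<Rightarrow> real) \<Rightarrow> real \<Rightarrow> real \<Rightarrow> 'v set" where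
  "interp_space X0 N0 X1 N1 \<theta> r =
     {x. (\<exists>x0\<in>X0. \<exists>x1\<in>X1. x = x0 + x1) \<and> interp_integral X0 N0 X1 N1 \<theta> r x < \<infinity>}"

definition interp_norm ::
  "'v::ab_group_add set \<Rightarrow> ('v \<Rightarrow> real) \<Rightarrow> 'v set \<Rightarrow> ('v \<Rightarrow> real) \<Rightarrow> real \<Rightarrow> real \<Rightarrow> 'v \<Rightarrow> real" where
  "interp_norm X0 N0 X1 N1 \<theta> r x = enn2real (interp_integral X0 N0 X1 N1 \<theta> r x) powr (1 / r)"

definition equal_with_equivalent_norms ::
  "'v set \<Rightarrow> ('v \<Rightarrow> real) \<Rightarrow> 'v set \<Rightarrow> ('v \<Rightarrow> real) \<Rightarrow> bool" where
  "equal_with_equivalent_norms X N Y M \<longleftrightarrow>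
     X = Y \<and> (\<exists>c>0. \<exists>C>0. \<forall>x\<in>X. c * N x \<le> M x \<and> M x \<le> C * N x)"

section \<open>The family of spaces \<open>H\<^sup>p\<close>\<close>

text \<open>The exponent ranges over \<open>{1..\<infinity>}\<close> in \<^typ>\<open>ennreal\<close>, where the inverse of \<open>\<infinity>\<close> is \<open>0\<close>.
  Both interpolation properties only involve finite exponents. Continuity of the inclusions of
  \<open>H p\<close> into the Hilbert space is not listed: as soon as all \<open>H q\<close> contain a fixed total system, it
  follows from the duality inequality by the closed graph theorem.\<close>

locale Hp_family =
  fixes H :: "ennreal \<Rightarrow> 'h::complex_hilbert_space set"
    and nrm :: "ennreal \<Rightarrow> 'h \<Rightarrow> real"
  assumes banach: "1 \<le> p \<Longrightarrow> complex_banach_space scaleC (H p) (nrm p)"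
    and H2_carrier: "H 2 = UNIV"
    and H2_norm: "nrm 2 x = norm x"
    and duality: "1 \<le> p \<Longrightarrow> inverse p + inverse q = 1 \<Longrightarrow> x \<in> H p \<Longrightarrow> y \<in> H q \<Longrightarrow>
          cmod (cinner x y) \<le> nrm p x * nrm q y"
    and interpolation_1_2: "0 < \<theta> \<Longrightarrow> \<theta> < 1 \<Longrightarrow> 1 / r = 1 - \<theta> / 2 \<Longrightarrow>
          equal_with_equivalent_norms
            (interp_space (H 1) (nrm 1) (H 2) (nrm 2) \<theta> r)
            (interp_norm (H 1) (nrm 1) (H 2) (nrm 2) \<theta> r)
            (H (ennreal r)) (nrm (ennreal r))"
    and interpolation_2_inf: "0 < \<theta> \<Longrightarrow> \<theta> < 1 \<Longrightarrow> 1 / r = (1 - \<theta>) / 2 \<Longrightarrow>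
          equal_with_equivalent_norms
            (interp_space (H 2) (nrm 2) (H \<infinity>) (nrm \<infinity>) \<theta> r)
            (interp_norm (H 2) (nrm 2) (H \<infinity>) (nrm \<infinity>) \<theta> r)
            (H (ennreal r)) (nrm (ennreal r))"

section \<open>The sequence spaces\<close>

text \<open>With \<open>Ninf\<close> the norm of \<open>H\<^sup>\<infinity>\<close>, the space \<open>l\<^sup>p(U)\<close> is \<open>lp_space Ninf u v p\<close> and \<open>l\<^sup>p(V)\<close> is
  \<open>lp_space Ninf v u p\<close>. Membership is finiteness of the sum or supremum in \<open>lp_norm\<close>.\<close>

definition lp_space ::
  "('h \<Rightarrow> real) \<Rightarrow> ('i \<Rightarrow> 'h) \<Rightarrow> ('i \<Rightarrow> 'h) \<Rightarrow> ennreal \<Rightarrow> ('i \<Rightarrow> complex) set" where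
  "lp_space Ninf u v p =
     {a. if p = \<infinity> then bdd_above (range (\<lambda>\<xi>. cmod (a \<xi>) * inverse (Ninf (v \<xi>))))
         else if p \<le> 2 then
           (\<lambda>\<xi>. cmod (a \<xi>) powr enn2real p * Ninf (u \<xi>) powr (2 - enn2real p)) summable_on UNIV
         else
           (\<lambda>\<xi>. cmod (a \<xi>) powr enn2real p * Ninf (v \<xi>) powr (2 - enn2real p)) summable_on UNIV}"

definition lp_norm ::
  "('h \<Rightarrow> real) \<Rightarrow> ('i \<Rightarrow> 'h) \<Rightarrow> ('i \<Rightarrow> 'h) \<Rightarrow> ennreal \<Rightarrow> ('i \<Rightarrow> complex) \<Rightarrow> real" where
  "lp_norm Ninf u v p a =
     (if p = \<infinity> then (SUP \<xi>. cmod (a \<xi>) * inverse (Ninf (v \<xi>)))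
      else if p \<le> 2 then
        (\<Sum>\<^sub>\<infinity>\<xi>. cmod (a \<xi>) powr enn2real p * Ninf (u \<xi>) powr (2 - enn2real p)) powr (1 / enn2real p)
      else
        (\<Sum>\<^sub>\<infinity>\<xi>. cmod (a \<xi>) powr enn2real p * Ninf (v \<xi>) powr (2 - enn2real p)) powr (1 / enn2real p))"

definition pairing_functional ::
  "('i \<Rightarrow> complex) set \<Rightarrow> ('i \<Rightarrow> complex) \<Rightarrow> ('i \<Rightarrow> complex) \<Rightarrow> complex" where
  "pairing_functional X b = (\<lambda>a. if a \<in> X then (\<Sum>\<^sub>\<infinity>\<xi>. a \<xi> * b \<xi>) else 0)"

text \<open>\<open>(X, N)' = (Y, M)\<close> through the bilinear pairing. An infinite sum that does not converge has the
  value \<open>0\<close>, so convergence of the pairing is required explicitly.\<close>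

definition dual_via_pairing ::
  "('i \<Rightarrow> complex) set \<Rightarrow> (('i \<Rightarrow> complex) \<Rightarrow> real) \<Rightarrow>
   ('i \<Rightarrow> complex) set \<Rightarrow> (('i \<Rightarrow> complex) \<Rightarrow> real) \<Rightarrow> bool" where
  "dual_via_pairing X N Y M \<longleftrightarrow>
     (\<forall>a\<in>X. \<forall>b\<in>Y. (\<lambda>\<xi>. a \<xi> * b \<xi>) summable_on UNIV) \<and>
     banach_isomorphism fun_scale Y M
       fun_scale (dual_space fun_scale X N) (dual_norm X N) (pairing_functional X)"

end

theory Submission
  imports Defs
begin

text \<open>Both pairs of spaces are weighted sequence spaces with norms \<open>\<parallel>c a\<parallel>\<^sub>p\<close> and \<open>\<parallel>b / c\<parallel>\<^sub>q\<close>, where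
  \<open>c\<close> is the power \<open>2 / p - 1\<close> of the same weight: \<open>1 / p + 1 / q = 1\<close> gives
  \<open>2 / q - 1 = - (2 / p - 1)\<close>, and \<open>p \<le> 2\<close> iff \<open>q \<ge> 2\<close>, so the two definitions of the norms select
  the same basis. The duality is then Hoelder's inequality together with its sharpness on finitely
  supported sequences, which are dense for finite \<open>p\<close>. Minkowski's inequality and completeness
  of the target space are inherited from the space of functionals through this isometry.\<close>

section \<open>The dual of a normed space\<close>

lemma vector_space_fun_scale: "vector_space fun_scale"
  by unfold_locales (auto simp: fun_scale_def fun_eq_iff algebra_simps)

lemma dual_spaceD:
  assumes "\<phi> \<in> dual_space s X N"
  shows "x \<notin> X \<Longrightarrow> \<phi> x = 0"
    and "x \<in> X \<Longrightarrow> y \<in> X \<Longrightarrow> \<phi> (x + y) = \<phi> x + \<phi> y"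
    and "x \<in> X \<Longrightarrow> \<phi> (s c x) = c * \<phi> x"
    and "\<exists>C. \<forall>x\<in>X. cmod (\<phi> x) \<le> C * N x"
  using assms by (auto simp: dual_space_def)

text \<open>The axioms on \<open>N\<close> are nonnegativity and homogeneity, so a weighted sequence
  space fits in before Minkowski's inequality is available for it. The norm axioms of the dual come
  from pointwise estimates.\<close>

locale dual_of_homogeneous_norm =
  fixes s :: "complex \<Rightarrow> 'v::ab_group_add \<Rightarrow> 'v" and X :: "'v set" and N :: "'v \<Rightarrow> real"
  assumes zero_X: "0 \<in> X" and N_zero: "N 0 = 0"
    and add_X: "x \<in> X \<Longrightarrow> y \<in> X \<Longrightarrow> x + y \<in> X"
    and scale_X: "x \<in> X \<Longrightarrow> s c x \<in> X"
    and N_nonneg: "x \<in> X \<Longrightarrow> 0 \<le> N x"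
    and N_scale: "x \<in> X \<Longrightarrow> N (s c x) = cmod c * N x"
begin

lemma bdd_above_dual:
  assumes "\<phi> \<in> dual_space s X N"
  shows "bdd_above ((\<lambda>x. cmod (\<phi> x)) ` {x\<in>X. N x \<le> 1})"
proof -
  obtain C where C: "\<And>x. x \<in> X \<Longrightarrow> cmod (\<phi> x) \<le> C * N x"
    using dual_spaceD(4)[OF assms] by blast
  \<comment> \<open>The constant supplied by \<open>dual_space\<close> may be negative, hence the
    absolute value.\<close>
  have "cmod (\<phi> x) \<le> \<bar>C\<bar>" if "x \<in> X" "N x \<le> 1" for x
  proof -
    have "C * N x \<le> \<bar>C\<bar> * N x"
      using N_nonneg[OF that(1)] by (intro mult_right_mono) auto
    also have "\<dots> \<le> \<bar>C\<bar> * 1"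
      using that by (intro mult_left_mono) auto
    finally show ?thesis using C[OF that(1)] by simp
  qed
  then show ?thesis by (auto simp: bdd_above_def)
qed

lemma dual_norm_nonneg:
  assumes "\<phi> \<in> dual_space s X N"
  shows "0 \<le> dual_norm X N \<phi>"
proof -
  have "cmod (\<phi> 0) \<le> dual_norm X N \<phi>"
    unfolding dual_norm_def using zero_X N_zero bdd_above_dual[OF assms] by (intro cSUP_upper) auto
  then show ?thesis using norm_ge_zero order_trans by blast
qed

text \<open>Rescaling \<open>x\<close> to a vector with \<open>N\<close> equal to 1 brings it under
  the supremum. If \<open>N x = 0\<close> this is impossible, but then the bound contained in
  \<open>dual_space\<close> already forces \<open>\<phi> x = 0\<close>.\<close>

lemma dual_norm_bound:
  assumes \<phi>: "\<phi> \<in> dual_space s X N" and x: "x \<in> X"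
  shows "cmod (\<phi> x) \<le> dual_norm X N \<phi> * N x"
proof (cases "N x = 0")
  case True
  then show ?thesis using dual_spaceD(4)[OF \<phi>] x by force
next
  case False
  then have pos: "N x > 0" using N_nonneg[OF x] by simp
  let ?y = "s (complex_of_real (inverse (N x))) x"
  have "N ?y = 1" using N_scale[OF x, of "complex_of_real (inverse (N x))"] pos
    by (simp add: norm_inverse)
  then have "cmod (\<phi> ?y) \<le> dual_norm X N \<phi>"
    unfolding dual_norm_def using bdd_above_dual[OF \<phi>] scale_X[OF x] by (intro cSUP_upper) auto
  then show ?thesis
    using pos by (simp add: dual_spaceD(3)[OF \<phi> x] norm_mult norm_divide norm_inverse field_simps)
qed

lemma dual_norm_le:
  assumes "0 \<le> C" and "\<And>x. x \<in> X \<Longrightarrow> cmod (\<phi> x) \<le> C * N x"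
  shows "dual_norm X N \<phi> \<le> C"
  unfolding dual_norm_def
proof (rule cSUP_least)
  show "{x \<in> X. N x \<le> 1} \<noteq> {}" using zero_X N_zero by auto
  show "cmod (\<phi> x) \<le> C" if "x \<in> {x \<in> X. N x \<le> 1}" for x
    using that assms mult_left_mono[of "N x" 1 C] by force
qed

lemma dual_spaceI:
  assumes "\<And>x. x \<notin> X \<Longrightarrow> \<phi> x = 0"
    and "\<And>x y. x \<in> X \<Longrightarrow> y \<in> X \<Longrightarrow> \<phi> (x + y) = \<phi> x + \<phi> y"
    and "\<And>c x. x \<in> X \<Longrightarrow> \<phi> (s c x) = c * \<phi> x"
    and "\<And>x. x \<in> X \<Longrightarrow> cmod (\<phi> x) \<le> C * N x"
  shows "\<phi> \<in> dual_space s X N"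
  using assms unfolding dual_space_def by blast

lemma dual_add:
  assumes "\<phi> \<in> dual_space s X N" "\<psi> \<in> dual_space s X N"
  shows "\<phi> + \<psi> \<in> dual_space s X N"
    and "dual_norm X N (\<phi> + \<psi>) \<le> dual_norm X N \<phi> + dual_norm X N \<psi>"
proof -
  have *: "cmod ((\<phi> + \<psi>) x) \<le> (dual_norm X N \<phi> + dual_norm X N \<psi>) * N x" if "x \<in> X" for x
    using norm_triangle_ineq[of "\<phi> x" "\<psi> x"] dual_norm_bound[OF assms(1) that]
      dual_norm_bound[OF assms(2) that] by (simp add: algebra_simps)
  show "\<phi> + \<psi> \<in> dual_space s X N"
    by (rule dual_spaceI[OF _ _ _ *]) (simp_all add: dual_spaceD[OF assms(1)] dual_spaceD[OF assms(2)] algebra_simps)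
  show "dual_norm X N (\<phi> + \<psi>) \<le> dual_norm X N \<phi> + dual_norm X N \<psi>"
    using * dual_norm_nonneg assms by (intro dual_norm_le) auto
qed

lemma dual_scale:
  assumes \<phi>: "\<phi> \<in> dual_space s X N"
  shows "fun_scale c \<phi> \<in> dual_space s X N"
    and "dual_norm X N (fun_scale c \<phi>) = cmod c * dual_norm X N \<phi>"
proof -
  have *: "cmod (fun_scale c \<phi> x) \<le> cmod c * dual_norm X N \<phi> * N x" if "x \<in> X" for x
    using mult_left_mono[OF dual_norm_bound[OF \<phi> that], of "cmod c"]
    by (simp add: fun_scale_def norm_mult mult.assoc)
  show mem: "fun_scale c \<phi> \<in> dual_space s X N"
    by (rule dual_spaceI[OF _ _ _ *]) (simp_all add: dual_spaceD[OF \<phi>] fun_scale_def algebra_simps)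
  show "dual_norm X N (fun_scale c \<phi>) = cmod c * dual_norm X N \<phi>"
  proof (rule antisym)
    show "dual_norm X N (fun_scale c \<phi>) \<le> cmod c * dual_norm X N \<phi>"
      using * dual_norm_nonneg[OF \<phi>] by (intro dual_norm_le) auto
    show "cmod c * dual_norm X N \<phi> \<le> dual_norm X N (fun_scale c \<phi>)"
    proof (cases "c = 0")
      case True
      then show ?thesis using dual_norm_nonneg[OF mem] by simp
    next
      case False
      \<comment> \<open>The reverse inequality is the pointwise bound for the scaled functional,
        divided by \<open>cmod c\<close>.\<close>
      have "dual_norm X N \<phi> \<le> inverse (cmod c) * dual_norm X N (fun_scale c \<phi>)"
      proof (rule dual_norm_le)
        show "0 \<le> inverse (cmod c) * dual_norm X N (fun_scale c \<phi>)"
          using dual_norm_nonneg[OF mem] by simp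
        show "cmod (\<phi> x) \<le> inverse (cmod c) * dual_norm X N (fun_scale c \<phi>) * N x" if "x \<in> X" for x
          using dual_norm_bound[OF mem that] False
          by (simp add: fun_scale_def norm_mult field_simps)
      qed
      then show ?thesis using False by (simp add: field_simps)
    qed
  qed
qed

text \<open>A Cauchy sequence of functionals is Cauchy at every point, so completeness of the
  complex numbers yields a pointwise limit. The Cauchy estimate is uniform relative to
  \<open>N x\<close> and survives in the limit, which gives both boundedness of the limit and
  convergence in norm.\<close>

lemma dual_complete:
  assumes f: "\<And>n. f n \<in> dual_space s X N"
    and cauchy: "\<And>e. 0 < e \<Longrightarrow> \<exists>M::nat. \<forall>m\<ge>M. \<forall>n\<ge>M. dual_norm X N (f m - f n) < e"
  shows "\<exists>l\<in>dual_space s X N. (\<lambda>n. dual_norm X N (f n - l)) \<longlonglongrightarrow> 0"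
proof -
  have diff: "\<phi> - \<psi> \<in> dual_space s X N"
    if "\<phi> \<in> dual_space s X N" "\<psi> \<in> dual_space s X N" for \<phi> \<psi>
  proof -
    have "\<phi> - \<psi> = \<phi> + fun_scale (-1) \<psi>" by (auto simp: fun_scale_def fun_eq_iff)
    then show ?thesis using dual_add(1)[OF that(1) dual_scale(1)[OF that(2), of "-1"]] by (simp only:)
  qed
  have close: "\<exists>M. \<forall>m\<ge>M. \<forall>n\<ge>M. \<forall>x\<in>X. cmod (f m x - f n x) \<le> e * N x" if e: "0 < e" for e
  proof -
    obtain M where M: "\<And>m n. m \<ge> M \<Longrightarrow> n \<ge> M \<Longrightarrow> dual_norm X N (f m - f n) < e"
      using cauchy[OF e] by blast
    have "cmod (f m x - f n x) \<le> e * N x" if "m \<ge> M" "n \<ge> M" "x \<in> X" for m n x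
    proof -
      have "cmod ((f m - f n) x) \<le> dual_norm X N (f m - f n) * N x"
        by (rule dual_norm_bound[OF diff[OF f f] that(3)])
      also have "\<dots> \<le> e * N x"
        using M[OF that(1,2)] N_nonneg[OF that(3)] by (intro mult_right_mono) auto
      finally show ?thesis by simp
    qed
    then show ?thesis by blast
  qed
  have "convergent (\<lambda>n. f n x)" for x
  proof (cases "x \<in> X")
    case False
    then show ?thesis using dual_spaceD(1)[OF f] by (simp add: convergent_const)
  next
    case True
    have "Cauchy (\<lambda>n. f n x)"
    proof (rule metric_CauchyI)
      fix e :: real assume e: "0 < e"
      \<comment> \<open>Adding 1 to the denominator covers the case \<open>N x = 0\<close>.\<close>
      define d where "d = e / (N x + 1)"
      have pos: "N x + 1 > 0" using N_nonneg[OF True] by simp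
      have d: "0 < d" "d * N x < e"
        using e pos by (auto simp: d_def field_simps)
      obtain M where M: "\<And>m n. m \<ge> M \<Longrightarrow> n \<ge> M \<Longrightarrow> cmod (f m x - f n x) \<le> d * N x"
        using close[OF d(1)] True by blast
      show "\<exists>M. \<forall>m\<ge>M. \<forall>n\<ge>M. dist (f m x) (f n x) < e"
        using M d(2) unfolding dist_norm by (meson le_less_trans)
    qed
    then show ?thesis by (simp add: Cauchy_convergent_iff)
  qed
  then have "\<exists>y. (\<lambda>n. f n x) \<longlonglongrightarrow> y" for x by (simp add: convergent_def)
  then obtain l where l: "\<And>x. (\<lambda>n. f n x) \<longlonglongrightarrow> l x" by metis
  have close_l: "\<exists>M. \<forall>n\<ge>M. \<forall>x\<in>X. cmod (f n x - l x) \<le> e * N x" if e: "0 < e" for e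
  proof -
    obtain M where M: "\<And>m n x. m \<ge> M \<Longrightarrow> n \<ge> M \<Longrightarrow> x \<in> X \<Longrightarrow> cmod (f m x - f n x) \<le> e * N x"
      using close[OF e] by blast
    \<comment> \<open>Let \<open>m\<close> tend to infinity in the Cauchy estimate with
      \<open>n\<close> fixed.\<close>
    have "cmod (f n x - l x) \<le> e * N x" if "n \<ge> M" "x \<in> X" for n x
      by (rule Lim_bounded[of "\<lambda>m. cmod (f n x - f m x)" _ M]) (intro tendsto_intros l, use M that in auto)
    then show ?thesis by blast
  qed
  have l_mem: "l \<in> dual_space s X N"
  proof -
    obtain n where n: "\<And>x. x \<in> X \<Longrightarrow> cmod (f n x - l x) \<le> 1 * N x" using close_l[of 1] by auto
    have "cmod (l x) \<le> (dual_norm X N (f n) + 1) * N x" if "x \<in> X" for x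
      using norm_triangle_ineq2[of "l x" "f n x"] n[OF that] dual_norm_bound[OF f that, of n]
      by (simp add: norm_minus_commute algebra_simps)
    moreover have "l x = 0" if "x \<notin> X" for x
      using l[of x] dual_spaceD(1)[OF f that] by (simp add: LIMSEQ_const_iff)
    moreover have "l (x + y) = l x + l y" if "x \<in> X" "y \<in> X" for x y
      using l[of "x + y"] tendsto_add[OF l[of x] l[of y]]
      unfolding dual_spaceD(2)[OF f that] by (rule LIMSEQ_unique)
    moreover have "l (s c x) = c * l x" if "x \<in> X" for c x
      using l[of "s c x"] tendsto_mult[OF tendsto_const l[of x]]
      unfolding dual_spaceD(3)[OF f that] by (rule LIMSEQ_unique)
    ultimately show ?thesis by (intro dual_spaceI) auto
  qed
  have "(\<lambda>n. dual_norm X N (f n - l)) \<longlonglongrightarrow> 0"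
  proof (rule LIMSEQ_I)
    fix e :: real assume e: "0 < e"
    obtain M where M: "\<And>n x. n \<ge> M \<Longrightarrow> x \<in> X \<Longrightarrow> cmod (f n x - l x) \<le> e / 2 * N x"
      using close_l[of "e / 2"] e by auto
    have "norm (dual_norm X N (f n - l) - 0) < e" if "n \<ge> M" for n
      using dual_norm_le[of "e / 2" "f n - l"] M[OF that] e dual_norm_nonneg[OF diff[OF f l_mem], of n] by auto
    then show "\<exists>M. \<forall>n\<ge>M. norm (dual_norm X N (f n - l) - 0) < e" by blast
  qed
  then show ?thesis using l_mem by blast
qed

lemma complex_banach_space_dual:
  "complex_banach_space fun_scale (dual_space s X N) (dual_norm X N)"
proof -
  interpret F: vector_space fun_scale by (rule vector_space_fun_scale)
  have zero: "0 \<in> dual_space s X N"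
    by (rule dual_spaceI[of _ 0]) auto
  have zero_iff: "dual_norm X N \<phi> = 0 \<longleftrightarrow> \<phi> = 0" if \<phi>: "\<phi> \<in> dual_space s X N" for \<phi>
  proof
    assume "dual_norm X N \<phi> = 0"
    then have "\<phi> x = 0" for x
      using dual_norm_bound[OF \<phi>, of x] dual_spaceD(1)[OF \<phi>, of x] by (cases "x \<in> X") auto
    then show "\<phi> = 0" by (auto simp: fun_eq_iff)
  next
    assume "\<phi> = 0"
    then show "dual_norm X N \<phi> = 0"
      using dual_norm_le[of 0 \<phi>] dual_norm_nonneg[OF \<phi>] by auto
  qed
  show ?thesis
    by unfold_locales
      (auto simp: F.subspace_def zero zero_iff dual_add dual_scale dual_norm_nonneg intro: dual_complete)
qed

end

section \<open>Transport of Banach space structure along a bijective isometry\<close>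

text \<open>Each axiom for \<open>M\<close> is pulled back from \<open>N'\<close>. Applied to the
  pairing map, this is where the triangle inequality and completeness of the target sequence space
  come from.\<close>

lemma complex_banach_space_isometry:
  assumes D: "complex_banach_space s' D N'" and s: "vector_space s"
    and add: "\<And>x y. x \<in> Y \<Longrightarrow> y \<in> Y \<Longrightarrow> x + y \<in> Y"
    and scale: "\<And>c x. x \<in> Y \<Longrightarrow> s c x \<in> Y"
    and T_add: "\<And>x y. x \<in> Y \<Longrightarrow> y \<in> Y \<Longrightarrow> T (x + y) = T x + T y"
    and T_scale: "\<And>c x. x \<in> Y \<Longrightarrow> T (s c x) = s' c (T x)"
    and bij: "bij_betw T Y D"
    and iso: "\<And>x. x \<in> Y \<Longrightarrow> N' (T x) = M x"
  shows "complex_banach_space s Y M"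
proof -
  interpret D: complex_banach_space s' D N' by (rule D)
  interpret Y: vector_space s by (rule s)
  have TD: "T x \<in> D" if "x \<in> Y" for x using bij that by (auto simp: bij_betw_def)
  \<comment> \<open>Surjectivity onto the subspace \<open>D\<close> makes \<open>Y\<close> nonempty;
    scaling any element by 0 then gives \<open>0 \<in> Y\<close>.\<close>
  obtain y where "y \<in> Y" using D.subspace_0[OF D.subspace_X] bij by (auto simp: bij_betw_def)
  then have zero: "0 \<in> Y" using scale[of y 0] by simp
  have T_diff: "x - y \<in> Y \<and> T (x - y) = T x - T y" if "x \<in> Y" "y \<in> Y" for x y
    using add[OF that(1) scale[OF that(2), of "-1"]] T_add[OF that(1) scale[OF that(2), of "-1"]]
      T_scale[OF that(2), of "-1"] by simp
  have T_zero: "T 0 = 0" using T_diff[OF zero zero] by simp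
  show ?thesis
  proof unfold_locales
    show "Y.subspace Y" using zero add scale by (auto simp: Y.subspace_def)
    show "0 \<le> M x" if "x \<in> Y" for x using D.N_nonneg[OF TD[OF that]] iso[OF that] by simp
    show "M x = 0 \<longleftrightarrow> x = 0" if "x \<in> Y" for x
      using D.N_eq_0_iff[OF TD[OF that]] iso[OF that] T_zero inj_onD[OF bij_betw_imp_inj_on[OF bij] _ that zero] TD[OF that] D.N_eq_0_iff[OF D.subspace_0[OF D.subspace_X]] D.subspace_0[OF D.subspace_X]
      by auto
    show "M (s c x) = cmod c * M x" if "x \<in> Y" for c x
      using D.N_scale[OF TD[OF that], of c] iso[OF that] iso[OF scale[OF that]] T_scale[OF that] by simp
    show "M (x + y) \<le> M x + M y" if "x \<in> Y" "y \<in> Y" for x y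
      using D.N_triangle[OF TD[OF that(1)] TD[OF that(2)]] that add by (simp flip: iso T_add)
    fix f :: "nat \<Rightarrow> _"
    assume f: "\<And>n. f n \<in> Y"
      and cauchy: "\<And>e. 0 < e \<Longrightarrow> \<exists>K::nat. \<forall>m\<ge>K. \<forall>n\<ge>K. M (f m - f n) < e"
    have "N' (T x - T y) = M (x - y)" if "x \<in> Y" "y \<in> Y" for x y
      using T_diff[OF that] iso by metis
    note [simp] = this
    have "\<exists>l\<in>D. (\<lambda>n. N' (T (f n) - l)) \<longlonglongrightarrow> 0"
      using f cauchy TD by (intro D.N_complete) simp_all
    then obtain l where "l \<in> Y" "(\<lambda>n. N' (T (f n) - T l)) \<longlonglongrightarrow> 0"
      using bij by (auto simp: bij_betw_def)
    then show "\<exists>l\<in>Y. (\<lambda>n. M (f n - l)) \<longlonglongrightarrow> 0" using f by auto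
  qed
qed

section \<open>Duality of sequence spaces from a sharp Hoelder inequality\<close>

text \<open>The axiom \<open>tail\<close> says that truncations to finite index sets converge in
  \<open>N\<close>; it restricts the first space to finite exponents. The axiom \<open>sharp\<close>
  is the converse of Hoelder's inequality tested on finitely supported sequences; its membership
  claim is what puts the coordinates of a functional into \<open>Y\<close>.\<close>

locale sequence_duality =
  fixes X Y :: "('i \<Rightarrow> complex) set" and N M :: "('i \<Rightarrow> complex) \<Rightarrow> real"
  assumes add_X: "a \<in> X \<Longrightarrow> b \<in> X \<Longrightarrow> a + b \<in> X"
    and scale_X: "a \<in> X \<Longrightarrow> fun_scale c a \<in> X"
    and N_nonneg: "a \<in> X \<Longrightarrow> 0 \<le> N a"
    and N_scale: "a \<in> X \<Longrightarrow> N (fun_scale c a) = cmod c * N a"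
    and finite_support_X: "finite F \<Longrightarrow> (\<And>\<xi>. \<xi> \<notin> F \<Longrightarrow> a \<xi> = 0) \<Longrightarrow> a \<in> X"
    and tail: "a \<in> X \<Longrightarrow>
          ((\<lambda>F. N (\<lambda>\<xi>. if \<xi> \<in> F then 0 else a \<xi>)) \<longlongrightarrow> 0) (finite_subsets_at_top UNIV)"
    and M_nonneg: "b \<in> Y \<Longrightarrow> 0 \<le> M b"
    and hoelder: "a \<in> X \<Longrightarrow> b \<in> Y \<Longrightarrow> finite F \<Longrightarrow> (\<Sum>\<xi>\<in>F. cmod (a \<xi> * b \<xi>)) \<le> N a * M b"
    and sharp: "0 \<le> C \<Longrightarrow>
          (\<And>F a. finite F \<Longrightarrow> (\<And>\<xi>. \<xi> \<notin> F \<Longrightarrow> a \<xi> = 0) \<Longrightarrow> cmod (\<Sum>\<xi>\<in>F. a \<xi> * b \<xi>) \<le> C * N a) \<Longrightarrow>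
          b \<in> Y \<and> M b \<le> C"
begin

sublocale dual_of_homogeneous_norm fun_scale X N
proof
  show zero: "0 \<in> X" using finite_support_X[of "{}" 0] by simp
  show "N 0 = 0" using N_scale[OF zero, of 0] by (simp add: fun_scale_def zero_fun_def)
qed (fact add_X scale_X N_nonneg N_scale)+

section \<open>The pairing as a map into the dual\<close>

lemma abs_summable_pairing:
  assumes "a \<in> X" "b \<in> Y"
  shows "(\<lambda>\<xi>. cmod (a \<xi> * b \<xi>)) summable_on UNIV"
  unfolding abs_summable_iff_bdd_above using hoelder[OF assms] by (auto simp: bdd_above_def)

lemma summable_pairing:
  assumes "a \<in> X" "b \<in> Y"
  shows "(\<lambda>\<xi>. a \<xi> * b \<xi>) summable_on UNIV"
  using abs_summable_pairing[OF assms] by (rule abs_summable_summable)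

lemma pairing_bound:
  assumes "a \<in> X" "b \<in> Y"
  shows "cmod (\<Sum>\<^sub>\<infinity>\<xi>. a \<xi> * b \<xi>) \<le> M b * N a"
proof -
  have "cmod (\<Sum>\<^sub>\<infinity>\<xi>. a \<xi> * b \<xi>) \<le> (\<Sum>\<^sub>\<infinity>\<xi>. cmod (a \<xi> * b \<xi>))"
    by (rule norm_infsum_bound[OF abs_summable_pairing[OF assms]])
  also have "\<dots> \<le> N a * M b"
    by (rule infsum_le_finite_sums[OF abs_summable_pairing[OF assms] hoelder[OF assms]])
  finally show ?thesis by (simp add: mult.commute)
qed

abbreviation "D \<equiv> dual_space fun_scale X N"
abbreviation "T \<equiv> pairing_functional X"

lemma pairing_in_dual:
  assumes b: "b \<in> Y"
  shows "T b \<in> D"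
proof (rule dual_spaceI[where C = "M b"])
  show "T b (x + y) = T b x + T b y" if "x \<in> X" "y \<in> X" for x y
    using that add_X summable_pairing[OF _ b]
    by (simp add: pairing_functional_def distrib_right infsum_add)
  show "T b (fun_scale c x) = c * T b x" if "x \<in> X" for c x
    using scale_X[OF that, of c] that
    by (simp add: pairing_functional_def mult.assoc infsum_cmult_right') (simp add: fun_scale_def mult.assoc infsum_cmult_right')
  show "cmod (T b x) \<le> M b * N x" if "x \<in> X" for x
    using pairing_bound[OF that b] that by (simp add: pairing_functional_def)
qed (simp add: pairing_functional_def)

section \<open>Inversion of the pairing\<close>

text \<open>The candidate inverse of \<open>T\<close>: density of finitely supported sequences makes
  a bounded functional determined by its values on the unit sequences.\<close>

definition coords :: "(('i \<Rightarrow> complex) \<Rightarrow> complex) \<Rightarrow> 'i \<Rightarrow> complex" where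
  "coords \<phi> \<xi> = \<phi> (\<lambda>\<eta>. if \<eta> = \<xi> then 1 else 0)"

lemma dual_finite_support:
  assumes \<phi>: "\<phi> \<in> D" and "finite F" "\<And>\<xi>. \<xi> \<notin> F \<Longrightarrow> a \<xi> = 0"
  shows "\<phi> a = (\<Sum>\<xi>\<in>F. a \<xi> * coords \<phi> \<xi>)"
  using assms(2,3)
proof (induction F arbitrary: a)
  case empty
  then have "a = 0" by (auto simp: fun_eq_iff)
  then show ?case using dual_spaceD(2)[OF \<phi> zero_X zero_X] by (simp only: add_0_left add_0_right sum.empty) (metis add_cancel_left_left)
next
  case (insert \<zeta> F)
  let ?e = "\<lambda>\<eta>. if \<eta> = \<zeta> then 1 else 0 :: complex"
  let ?a = "a(\<zeta> := 0)"
  have e: "?e \<in> X" by (rule finite_support_X[of "{\<zeta>}"]) auto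
  have a: "?a \<in> X" using insert.prems insert.hyps by (intro finite_support_X[of F]) auto
  have "a = fun_scale (a \<zeta>) ?e + ?a" by (auto simp: fun_scale_def fun_eq_iff)
  then have "\<phi> a = \<phi> (fun_scale (a \<zeta>) ?e + ?a)" by simp
  also have "\<dots> = a \<zeta> * coords \<phi> \<zeta> + \<phi> ?a"
    using dual_spaceD(2)[OF \<phi> scale_X[OF e] a] dual_spaceD(3)[OF \<phi> e] by (simp add: coords_def)
  also have "\<phi> ?a = (\<Sum>\<xi>\<in>F. ?a \<xi> * coords \<phi> \<xi>)"
    using insert.prems by (intro insert.IH) auto
  also have "\<dots> = (\<Sum>\<xi>\<in>F. a \<xi> * coords \<phi> \<xi>)"
    using insert.hyps by (intro sum.cong) auto
  finally show ?case using insert.hyps by simp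
qed

text \<open>On finitely supported sequences \<open>\<phi>\<close> is the pairing with
  \<open>coords \<phi>\<close>, so its norm bound is the premise of \<open>sharp\<close> with the
  dual norm as constant.\<close>

lemma coords_in_Y:
  assumes \<phi>: "\<phi> \<in> D"
  shows "coords \<phi> \<in> Y" and "M (coords \<phi>) \<le> dual_norm X N \<phi>"
proof -
  have "cmod (\<Sum>\<xi>\<in>F. a \<xi> * coords \<phi> \<xi>) \<le> dual_norm X N \<phi> * N a"
    if F: "finite F" "\<And>\<xi>. \<xi> \<notin> F \<Longrightarrow> a \<xi> = 0" for F a
    using dual_norm_bound[OF \<phi> finite_support_X[OF F]] dual_finite_support[OF \<phi> F] by simp
  then show "coords \<phi> \<in> Y" "M (coords \<phi>) \<le> dual_norm X N \<phi>"
    using sharp[OF dual_norm_nonneg[OF \<phi>]] by blast+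
qed

lemma coords_pairing:
  "coords (T b) = b"
proof
  fix \<xi>
  have "(\<lambda>\<eta>. if \<eta> = \<xi> then 1 else 0 :: complex) \<in> X"
    by (rule finite_support_X[of "{\<xi>}"]) auto
  then have "coords (T b) \<xi> = (\<Sum>\<^sub>\<infinity>\<eta>. (if \<eta> = \<xi> then 1 else 0) * b \<eta>)"
    by (simp add: coords_def pairing_functional_def)
  also have "\<dots> = (\<Sum>\<^sub>\<infinity>\<eta>\<in>{\<xi>}. b \<eta>)" by (rule infsum_cong_neutral) auto
  finally show "coords (T b) \<xi> = b \<xi>" by simp
qed

text \<open>The finite sums of the pairing are the values of \<open>\<phi>\<close> on truncations of
  \<open>a\<close>. They differ from \<open>\<phi> a\<close> by the value on the tail, which tends
  to 0 by \<open>tail\<close>. They also converge to the infinite sum, and limits are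
  unique.\<close>

lemma pairing_coords:
  assumes \<phi>: "\<phi> \<in> D"
  shows "T (coords \<phi>) = \<phi>"
proof
  fix a
  show "T (coords \<phi>) a = \<phi> a"
  proof (cases "a \<in> X")
    case False
    then show ?thesis by (simp add: pairing_functional_def dual_spaceD(1)[OF \<phi>])
  next
    case True
    let ?S = "\<lambda>F. \<Sum>\<xi>\<in>F. a \<xi> * coords \<phi> \<xi>"
    let ?G = "finite_subsets_at_top (UNIV :: 'i set)"
    have "norm (?S F - \<phi> a) \<le> dual_norm X N \<phi> * N (\<lambda>\<xi>. if \<xi> \<in> F then 0 else a \<xi>)"
      if F: "finite F" for F
    proof -
      let ?h = "\<lambda>\<xi>. if \<xi> \<in> F then a \<xi> else 0" and ?t = "\<lambda>\<xi>. if \<xi> \<in> F then 0 else a \<xi>"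
      have h: "?h \<in> X" using F by (rule finite_support_X) auto
      \<comment> \<open>Written this way, the tail lies in \<open>X\<close> by closure under
        addition and scaling.\<close>
      have "?t = a + fun_scale (-1) ?h" by (auto simp: fun_scale_def fun_eq_iff)
      then have t: "?t \<in> X" using add_X[OF True scale_X[OF h, of "-1"]] by simp
      have "a = ?h + ?t" by (auto simp: fun_eq_iff)
      then have "\<phi> a = \<phi> ?h + \<phi> ?t" using dual_spaceD(2)[OF \<phi> h t] by simp
      moreover have "\<phi> ?h = ?S F" using dual_finite_support[OF \<phi> F, of ?h] by simp
      ultimately show ?thesis using dual_norm_bound[OF \<phi> t] by (simp add: norm_minus_commute)
    qed
    then have "eventually (\<lambda>F. norm (?S F - \<phi> a) \<le>
        dual_norm X N \<phi> * N (\<lambda>\<xi>. if \<xi> \<in> F then 0 else a \<xi>)) ?G"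
      by (intro eventually_finite_subsets_at_top_weakI)
    moreover have "((\<lambda>F. dual_norm X N \<phi> * N (\<lambda>\<xi>. if \<xi> \<in> F then 0 else a \<xi>)) \<longlongrightarrow> 0) ?G"
      using tendsto_mult_right_zero[OF tail[OF True]] by simp
    ultimately have "((\<lambda>F. ?S F - \<phi> a) \<longlongrightarrow> 0) ?G" by (rule Lim_null_comparison)
    then have "(?S \<longlongrightarrow> \<phi> a) ?G" by (simp add: LIM_zero_iff)
    moreover have "(?S \<longlongrightarrow> T (coords \<phi>) a) ?G"
      using infsum_tendsto[OF summable_pairing[OF True coords_in_Y(1)[OF \<phi>]]] True
      by (simp add: pairing_functional_def)
    ultimately show ?thesis by (rule tendsto_unique[OF finite_subsets_at_top_neq_bot, rotated])
  qed
qed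

lemma bij_pairing: "bij_betw T Y D"
  by (rule bij_betw_byWitness[where f' = coords])
    (auto simp: coords_pairing pairing_coords pairing_in_dual coords_in_Y)

text \<open>One inequality is Hoelder's; the other is \<open>coords_in_Y\<close> for
  \<open>T b\<close>, whose coordinates are \<open>b\<close> again.\<close>

lemma dual_norm_pairing:
  assumes b: "b \<in> Y"
  shows "dual_norm X N (T b) = M b"
proof (rule antisym)
  show "dual_norm X N (T b) \<le> M b"
    using pairing_bound[OF _ b] M_nonneg[OF b]
    by (intro dual_norm_le) (auto simp: pairing_functional_def)
  show "M b \<le> dual_norm X N (T b)"
    using coords_in_Y(2)[OF pairing_in_dual[OF b]] by (simp add: coords_pairing)
qed

lemma pairing_add:
  assumes "b \<in> Y" "d \<in> Y"
  shows "T (b + d) = T b + T d"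
  using assms summable_pairing
  by (auto simp: pairing_functional_def fun_eq_iff distrib_left infsum_add)

lemma pairing_scale: "T (fun_scale c b) = fun_scale c (T b)"
  by (auto simp: pairing_functional_def fun_eq_iff fun_scale_def mult.left_commute[of _ c]
      infsum_cmult_right')

text \<open>The sum of the two functionals lies in the dual, so its coordinates, which are those of
  \<open>b + d\<close>, lie in \<open>Y\<close>.\<close>

lemma add_Y:
  assumes "b \<in> Y" "d \<in> Y"
  shows "b + d \<in> Y"
  using coords_in_Y(1)[OF dual_add(1)[OF pairing_in_dual[OF assms(1)] pairing_in_dual[OF assms(2)]]]
  by (simp add: coords_pairing flip: pairing_add[OF assms])

lemma scale_Y:
  assumes "b \<in> Y"
  shows "fun_scale c b \<in> Y"
  using coords_in_Y(1)[OF dual_scale(1)[OF pairing_in_dual[OF assms], of c]]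
  by (simp add: coords_pairing flip: pairing_scale)

theorem dual_via_pairing: "dual_via_pairing X N Y M"
proof -
  have "complex_banach_space fun_scale Y M"
    by (rule complex_banach_space_isometry[OF complex_banach_space_dual vector_space_fun_scale
          _ _ _ _ bij_pairing])
      (simp_all add: add_Y scale_Y pairing_add pairing_scale dual_norm_pairing)
  moreover have "\<exists>C. \<forall>b\<in>Y. dual_norm X N (T b) \<le> C * M b" "\<exists>C. \<forall>b\<in>Y. M b \<le> C * dual_norm X N (T b)"
    by (rule exI[of _ 1]; simp add: dual_norm_pairing)+
  ultimately show ?thesis
    by (simp add: dual_via_pairing_def banach_isomorphism_def summable_pairing pairing_add
        pairing_scale bij_pairing complex_banach_space_dual)
qed

end

section \<open>Weighted sequence spaces\<close>

text \<open>With the weight inside the power, passing to the dual exponent just replaces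
  \<open>c\<close> by its inverse.\<close>

definition wlp_space :: "('i \<Rightarrow> real) \<Rightarrow> real \<Rightarrow> ('i \<Rightarrow> complex) set" where
  "wlp_space c p = {a. (\<lambda>\<xi>. (c \<xi> * cmod (a \<xi>)) powr p) summable_on UNIV}"

definition wlp_norm :: "('i \<Rightarrow> real) \<Rightarrow> real \<Rightarrow> ('i \<Rightarrow> complex) \<Rightarrow> real" where
  "wlp_norm c p a = (\<Sum>\<^sub>\<infinity>\<xi>. (c \<xi> * cmod (a \<xi>)) powr p) powr (1 / p)"

lemma wlp_norm_powr:
  assumes "p \<noteq> 0"
  shows "wlp_norm c p a powr p = (\<Sum>\<^sub>\<infinity>\<xi>. (c \<xi> * cmod (a \<xi>)) powr p)"
  using assms by (simp add: wlp_norm_def powr_powr infsum_nonneg)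

lemma wlp_norm_finite:
  assumes "finite F" "\<And>\<xi>. \<xi> \<notin> F \<Longrightarrow> a \<xi> = 0"
  shows "a \<in> wlp_space c p" and "wlp_norm c p a = (\<Sum>\<xi>\<in>F. (c \<xi> * cmod (a \<xi>)) powr p) powr (1 / p)"
proof -
  let ?f = "\<lambda>\<xi>. (c \<xi> * cmod (a \<xi>)) powr p"
  have "?f summable_on UNIV \<longleftrightarrow> ?f summable_on F" "infsum ?f UNIV = infsum ?f F"
    using assms(2) by (intro summable_on_cong_neutral infsum_cong_neutral; auto)+
  then show "a \<in> wlp_space c p" "wlp_norm c p a = (\<Sum>\<xi>\<in>F. ?f \<xi>) powr (1 / p)"
    using assms(1) by (auto simp: wlp_space_def wlp_norm_def)
qed

lemma sum_le_wlp_norm_powr: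
  assumes "a \<in> wlp_space c p" "p \<noteq> 0" "finite F"
  shows "(\<Sum>\<xi>\<in>F. (c \<xi> * cmod (a \<xi>)) powr p) \<le> wlp_norm c p a powr p"
  using assms by (auto simp: wlp_norm_powr wlp_space_def intro: finite_sum_le_infsum)

text \<open>Only membership is at stake, so the crude estimate
  \<open>(x + y) powr p \<le> 2 powr p * (x powr p + y powr p)\<close>, from
  \<open>x + y \<le> 2 * max x y\<close>, replaces Minkowski's inequality.\<close>

lemma wlp_space_add:
  assumes c: "\<And>\<xi>. c \<xi> > (0::real)" and p: "p > 0"
    and a: "a \<in> wlp_space c p" and b: "b \<in> wlp_space c p"
  shows "a + b \<in> wlp_space c p"
proof -
  have "(\<lambda>\<xi>. 2 powr p * ((c \<xi> * cmod (a \<xi>)) powr p + (c \<xi> * cmod (b \<xi>)) powr p)) summable_on UNIV"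
    using a b by (intro summable_on_cmult_right summable_on_add) (auto simp: wlp_space_def)
  moreover have "(c \<xi> * cmod ((a + b) \<xi>)) powr p
      \<le> 2 powr p * ((c \<xi> * cmod (a \<xi>)) powr p + (c \<xi> * cmod (b \<xi>)) powr p)" for \<xi>
  proof -
    let ?x = "c \<xi> * cmod (a \<xi>)" and ?y = "c \<xi> * cmod (b \<xi>)"
    have "c \<xi> * cmod ((a + b) \<xi>) \<le> c \<xi> * (cmod (a \<xi>) + cmod (b \<xi>))"
      using norm_triangle_ineq less_imp_le[OF c] by (intro mult_left_mono) auto
    also have "\<dots> = ?x + ?y" by (simp add: algebra_simps)
    also have "\<dots> \<le> 2 * max ?x ?y" by simp
    finally have "(c \<xi> * cmod ((a + b) \<xi>)) powr p \<le> (2 * max ?x ?y) powr p"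
      using p less_imp_le[OF c[of \<xi>]] by (intro powr_mono2) auto
    also have "\<dots> = 2 powr p * max ?x ?y powr p"
      by (rule powr_mult)
    also have "max ?x ?y powr p \<le> ?x powr p + ?y powr p" by (simp add: max_def)
    finally show ?thesis by simp
  qed
  ultimately show ?thesis unfolding wlp_space_def by (auto intro: summable_on_comparison_test)
qed

lemma wlp_space_scale:
  assumes p: "p > 0" and a: "a \<in> wlp_space c p"
  shows "fun_scale k a \<in> wlp_space c p" and "wlp_norm c p (fun_scale k a) = cmod k * wlp_norm c p a"
proof -
  have *: "(c \<xi> * cmod (fun_scale k a \<xi>)) powr p = cmod k powr p * (c \<xi> * cmod (a \<xi>)) powr p" for \<xi>
  proof -
    have "c \<xi> * cmod (fun_scale k a \<xi>) = cmod k * (c \<xi> * cmod (a \<xi>))"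
      by (simp add: fun_scale_def norm_mult)
    then show ?thesis by (simp only: powr_mult)
  qed
  show "fun_scale k a \<in> wlp_space c p"
    using a unfolding wlp_space_def mem_Collect_eq * by (rule summable_on_cmult_right)
  show "wlp_norm c p (fun_scale k a) = cmod k * wlp_norm c p a"
    using p unfolding wlp_norm_def * infsum_cmult_right'
    by (simp add: powr_mult powr_powr infsum_nonneg)
qed

text \<open>The norm of the tail is the \<open>p\<close>-th root of the full sum minus the finite
  sum over \<open>F\<close>, and that difference tends to 0.\<close>

lemma wlp_norm_tail:
  assumes p: "p > 0" and a: "a \<in> wlp_space c p"
  shows "((\<lambda>F. wlp_norm c p (\<lambda>\<xi>. if \<xi> \<in> F then 0 else a \<xi>)) \<longlongrightarrow> 0) (finite_subsets_at_top UNIV)"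
proof -
  let ?f = "\<lambda>\<xi>. (c \<xi> * cmod (a \<xi>)) powr p"
  have f: "?f summable_on UNIV" using a by (simp add: wlp_space_def)
  have eq: "wlp_norm c p (\<lambda>\<xi>. if \<xi> \<in> F then 0 else a \<xi>) = (infsum ?f UNIV - sum ?f F) powr (1 / p)"
    if F: "finite F" for F
  proof -
    have "(\<Sum>\<^sub>\<infinity>\<xi>. (c \<xi> * cmod (if \<xi> \<in> F then 0 else a \<xi>)) powr p) = infsum ?f (UNIV - F)"
      by (rule infsum_cong_neutral) auto
    also have "\<dots> = infsum ?f UNIV - infsum ?f F"
      using f F by (intro infsum_Diff) auto
    finally show ?thesis using F by (simp add: wlp_norm_def)
  qed
  have "((\<lambda>F. infsum ?f UNIV - sum ?f F) \<longlongrightarrow> infsum ?f UNIV - infsum ?f UNIV) (finite_subsets_at_top UNIV)"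
    by (intro tendsto_intros infsum_tendsto f)
  then have "((\<lambda>F. (infsum ?f UNIV - sum ?f F) powr (1 / p)) \<longlongrightarrow> 0 powr (1 / p)) (finite_subsets_at_top UNIV)"
    \<comment> \<open>Continuity of the root at base 0 needs the differences to be nonnegative and
      the exponent positive.\<close>
    using p f by (intro tendsto_powr2)
      (auto intro!: eventually_finite_subsets_at_top_weakI finite_sum_le_infsum)
  then show ?thesis
    using p by (elim Lim_transform_eventually[THEN tendsto_eq_rhs])
      (auto intro!: eventually_finite_subsets_at_top_weakI simp: eq)
qed

section \<open>Hoelder's inequality with weights and its converse\<close>

text \<open>The weights cancel in each product. After normalising by the two norms, Young's
  inequality is applied termwise and the sums add up to at most
  \<open>1 / p + 1 / q\<close>.\<close>

lemma wlp_hoelder: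
  assumes c: "\<And>\<xi>. c \<xi> > (0::real)" and pq: "p > 1" "q > 1" "1 / p + 1 / q = 1"
    and a: "a \<in> wlp_space c p" and b: "b \<in> wlp_space (\<lambda>\<xi>. inverse (c \<xi>)) q" and F: "finite F"
  shows "(\<Sum>\<xi>\<in>F. cmod (a \<xi> * b \<xi>)) \<le> wlp_norm c p a * wlp_norm (\<lambda>\<xi>. inverse (c \<xi>)) q b"
proof -
  define A where "A = wlp_norm c p a"
  define B where "B = wlp_norm (\<lambda>\<xi>. inverse (c \<xi>)) q b"
  define f where "f \<xi> = c \<xi> * cmod (a \<xi>)" for \<xi>
  define g where "g \<xi> = inverse (c \<xi>) * cmod (b \<xi>)" for \<xi>
  have nonneg: "f \<xi> \<ge> 0" "g \<xi> \<ge> 0" for \<xi>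
    using less_imp_le[OF c[of \<xi>]] by (simp_all add: f_def g_def)
  have fg: "cmod (a \<xi> * b \<xi>) = f \<xi> * g \<xi>" for \<xi>
    using c[of \<xi>] by (simp add: f_def g_def norm_mult)
  have A: "(\<Sum>\<xi>\<in>G. f \<xi> powr p) \<le> A powr p" and B: "(\<Sum>\<xi>\<in>G. g \<xi> powr q) \<le> B powr q" if "finite G" for G
    using sum_le_wlp_norm_powr[OF a _ that] sum_le_wlp_norm_powr[OF b _ that] pq
    by (simp_all add: A_def B_def f_def g_def)
  have AB: "A \<ge> 0" "B \<ge> 0" by (simp_all add: A_def B_def wlp_norm_def)
  show ?thesis
  \<comment> \<open>Normalisation fails for a vanishing norm; the bounds on one-point sums then make
    every product zero.\<close>
  proof (cases "A = 0 \<or> B = 0")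
    case True
    have "f \<xi> * g \<xi> = 0" for \<xi>
      using True A[of "{\<xi>}"] B[of "{\<xi>}"] by auto
    then have "(\<Sum>\<xi>\<in>F. cmod (a \<xi> * b \<xi>)) = 0" unfolding fg by (intro sum.neutral) simp
    then show ?thesis using AB by (simp flip: A_def B_def)
  next
    case False
    then have pos: "A > 0" "B > 0" using AB by auto
    have "(\<Sum>\<xi>\<in>F. cmod (a \<xi> * b \<xi>)) = A * B * (\<Sum>\<xi>\<in>F. (f \<xi> / A) * (g \<xi> / B))"
      using pos by (simp add: fg sum_distrib_left)
    also have "(\<Sum>\<xi>\<in>F. (f \<xi> / A) * (g \<xi> / B)) \<le> (\<Sum>\<xi>\<in>F. (f \<xi> / A) powr p / p + (g \<xi> / B) powr q / q)"
      using pos nonneg pq by (intro sum_mono Youngs_inequality) auto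
    also have "\<dots> = (\<Sum>\<xi>\<in>F. f \<xi> powr p) / A powr p / p + (\<Sum>\<xi>\<in>F. g \<xi> powr q) / B powr q / q"
      using pos nonneg by (simp add: powr_divide sum.distrib sum_divide_distrib)
    also have "\<dots> \<le> 1 / p + 1 / q"
      using A[OF F] B[OF F] pos pq by (intro add_mono divide_right_mono) auto
    finally show ?thesis using pos pq by (simp flip: A_def B_def)
  qed
qed

text \<open>Testing with the extremal sequence on a finite set gives
  \<open>S \<le> C * S powr (1 / p)\<close>, where \<open>S\<close> is the finite sum of
  \<open>g \<xi> powr q\<close>. Cancelling leaves \<open>S powr (1 / q) \<le> C\<close> uniformly
  in the finite set, which yields summability and the norm bound together.\<close>

lemma wlp_sharp:
  assumes c: "\<And>\<xi>. c \<xi> > (0::real)" and pq: "p > 1" "q > 1" "1 / p + 1 / q = 1" and C: "0 \<le> C"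
    and bound: "\<And>F a. finite F \<Longrightarrow> (\<And>\<xi>. \<xi> \<notin> F \<Longrightarrow> a \<xi> = 0) \<Longrightarrow>
          cmod (\<Sum>\<xi>\<in>F. a \<xi> * b \<xi>) \<le> C * wlp_norm c p a"
  shows "b \<in> wlp_space (\<lambda>\<xi>. inverse (c \<xi>)) q" and "wlp_norm (\<lambda>\<xi>. inverse (c \<xi>)) q b \<le> C"
proof -
  define g where "g \<xi> = inverse (c \<xi>) * cmod (b \<xi>)" for \<xi>
  have g: "g \<xi> \<ge> 0" for \<xi> using less_imp_le[OF c[of \<xi>]] by (simp add: g_def)
  have sum_g: "(\<Sum>\<xi>\<in>F. g \<xi> powr q) \<le> C powr q" if F: "finite F" for F
  proof -
    define S where "S = (\<Sum>\<xi>\<in>F. g \<xi> powr q)"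
    have S: "S \<ge> 0" unfolding S_def by (intro sum_nonneg) simp
    \<comment> \<open>The equality case of Hoelder's inequality: \<open>c |a| = g\<^sup>q\<^sup>-\<^sup>1\<close> and \<open>a b \<ge> 0\<close>.\<close>
    define a where "a \<xi> = (if \<xi> \<in> F then of_real (g \<xi> powr (q - 1) / c \<xi>) * cnj (sgn (b \<xi>)) else 0)" for \<xi>
    have "a \<xi> * b \<xi> = of_real (g \<xi> powr q)" if "\<xi> \<in> F" for \<xi>
    proof -
      have "cnj (sgn (b \<xi>)) * b \<xi> = of_real (cmod (b \<xi>))"
        using complex_norm_square[of "b \<xi>"]
        by (cases "b \<xi> = 0") (simp_all add: sgn_div_norm scaleR_conv_of_real power2_eq_square field_simps)
      then have "a \<xi> * b \<xi> = of_real (g \<xi> powr (q - 1) / c \<xi> * cmod (b \<xi>))"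
        using that by (simp add: a_def mult.assoc)
      also have "g \<xi> powr (q - 1) / c \<xi> * cmod (b \<xi>) = g \<xi> powr (q - 1) * g \<xi> powr 1"
        using g[of \<xi>] by (simp add: g_def divide_inverse)
      also have "\<dots> = g \<xi> powr q" by (simp only: powr_add[symmetric]) simp
      finally show ?thesis .
    qed
    then have "(\<Sum>\<xi>\<in>F. a \<xi> * b \<xi>) = of_real S" by (simp add: S_def)
    moreover have "wlp_norm c p a = S powr (1 / p)"
    proof -
      have q: "(q - 1) * p = q" using pq by (simp add: field_simps)
      have "(c \<xi> * cmod (a \<xi>)) powr p = g \<xi> powr q" if "\<xi> \<in> F" for \<xi>
      \<comment> \<open>Only a nonzero entry has a sign of modulus 1; for a zero entry both sides
        vanish.\<close>
      proof (cases "b \<xi> = 0")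
        case True
        then show ?thesis by (simp add: a_def g_def)
      next
        case False
        then have "c \<xi> * cmod (a \<xi>) = g \<xi> powr (q - 1)"
          using that c[of \<xi>] by (simp add: a_def norm_mult norm_sgn norm_divide)
        then show ?thesis by (simp add: powr_powr q)
      qed
      then show ?thesis
        using wlp_norm_finite(2)[OF F, of a c p] by (simp add: a_def S_def)
    qed
    ultimately have le: "S \<le> C * S powr (1 / p)"
      using bound[OF F, of a] S by (simp add: a_def)
    have "S powr (1 / q) \<le> C"
    proof (cases "S = 0")
      case False
      \<comment> \<open>Splitting \<open>S\<close> by \<open>1 / p + 1 / q = 1\<close> lets the
        positive factor \<open>S powr (1 / p)\<close> cancel.\<close>
      then have "S = S powr (1 / p) * S powr (1 / q)" using S pq by (simp flip: powr_add)
      then have "S powr (1 / p) * S powr (1 / q) \<le> S powr (1 / p) * C" using le by (simp add: mult.commute)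
      then show ?thesis using False S by simp
    qed (use C in simp)
    then have "(S powr (1 / q)) powr q \<le> C powr q" using pq by (intro powr_mono2) auto
    then show ?thesis using S pq by (simp add: powr_powr S_def)
  qed
  have summable: "(\<lambda>\<xi>. g \<xi> powr q) summable_on UNIV"
    using sum_g by (intro nonneg_bdd_above_summable_on) (auto simp: bdd_above_def)
  then show "b \<in> wlp_space (\<lambda>\<xi>. inverse (c \<xi>)) q" by (simp add: wlp_space_def g_def)
  have "(\<Sum>\<^sub>\<infinity>\<xi>. g \<xi> powr q) powr (1 / q) \<le> (C powr q) powr (1 / q)"
    using summable sum_g pq by (intro powr_mono2 infsum_le_finite_sums infsum_nonneg) auto
  then show "wlp_norm (\<lambda>\<xi>. inverse (c \<xi>)) q b \<le> C"
    using C pq by (simp add: wlp_norm_def g_def powr_powr)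
qed

section \<open>Duality of the weighted spaces\<close>

lemma dual_via_pairing_wlp:
  assumes c: "\<And>\<xi>. c \<xi> > (0::real)" and pq: "p > 1" "q > 1" "1 / p + 1 / q = 1"
  shows "dual_via_pairing (wlp_space c p) (wlp_norm c p)
    (wlp_space (\<lambda>\<xi>. inverse (c \<xi>)) q) (wlp_norm (\<lambda>\<xi>. inverse (c \<xi>)) q)"
proof -
  have p: "p > 0" using pq by simp
  interpret sequence_duality "wlp_space c p" "wlp_space (\<lambda>\<xi>. inverse (c \<xi>)) q"
      "wlp_norm c p" "wlp_norm (\<lambda>\<xi>. inverse (c \<xi>)) q"
  proof
    show "b \<in> wlp_space (\<lambda>\<xi>. inverse (c \<xi>)) q \<and> wlp_norm (\<lambda>\<xi>. inverse (c \<xi>)) q b \<le> C"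
      if "0 \<le> C" "\<And>F a. finite F \<Longrightarrow> (\<And>\<xi>. \<xi> \<notin> F \<Longrightarrow> a \<xi> = 0) \<Longrightarrow>
          cmod (\<Sum>\<xi>\<in>F. a \<xi> * b \<xi>) \<le> C * wlp_norm c p a" for C b
      using wlp_sharp[OF c pq that] by blast
  qed (fact wlp_space_add[OF c p] wlp_space_scale[OF p] wlp_norm_finite(1) wlp_norm_tail[OF p]
      wlp_hoelder[OF c pq] | simp add: wlp_norm_def)+
  show ?thesis by (rule dual_via_pairing)
qed

text \<open>For exponent 1 the extremal sequences are the unit sequences: the one at
  \<open>\<xi>\<close> has norm \<open>c \<xi>\<close> and pairs with \<open>b\<close> to
  \<open>b \<xi>\<close>.\<close>

lemma dual_via_pairing_wl1:
  fixes c :: "'i \<Rightarrow> real"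
  assumes c: "\<And>\<xi>. c \<xi> > 0"
  shows "dual_via_pairing (wlp_space c 1) (wlp_norm c 1)
    {b. bdd_above (range (\<lambda>\<xi>. cmod (b \<xi>) * inverse (c \<xi>)))} (\<lambda>b. SUP \<xi>. cmod (b \<xi>) * inverse (c \<xi>))"
    (is "dual_via_pairing _ _ ?Y ?M")
proof -
  have upper: "cmod (b \<xi>) * inverse (c \<xi>) \<le> ?M b" if "b \<in> ?Y" for b \<xi>
    using that by (intro cSUP_upper) auto
  have M: "0 \<le> ?M b" if "b \<in> ?Y" for b
    using upper[OF that] c by (meson less_imp_le mult_nonneg_nonneg norm_ge_zero order_trans positive_imp_inverse_positive)
  interpret sequence_duality "wlp_space c 1" ?Y "wlp_norm c 1" ?M
  proof
    fix a b :: "'i \<Rightarrow> complex" and F :: "'i set"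
    assume a: "a \<in> wlp_space c 1" and b: "b \<in> ?Y" and F: "finite F"
    have "cmod (a \<xi> * b \<xi>) \<le> c \<xi> * cmod (a \<xi>) * ?M b" for \<xi>
      using mult_left_mono[OF upper[OF b, of \<xi>], of "c \<xi> * cmod (a \<xi>)"] c[of \<xi>]
      by (simp add: norm_mult field_simps)
    then have "(\<Sum>\<xi>\<in>F. cmod (a \<xi> * b \<xi>)) \<le> (\<Sum>\<xi>\<in>F. c \<xi> * cmod (a \<xi>)) * ?M b"
      unfolding sum_distrib_right by (intro sum_mono)
    also have "\<dots> \<le> wlp_norm c 1 a * ?M b"
      using sum_le_wlp_norm_powr[OF a _ F] less_imp_le[OF c] M[OF b]
      by (intro mult_right_mono) (auto simp: wlp_norm_def infsum_nonneg)
    finally show "(\<Sum>\<xi>\<in>F. cmod (a \<xi> * b \<xi>)) \<le> wlp_norm c 1 a * ?M b" .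
  next
    fix C :: real and b :: "'i \<Rightarrow> complex"
    assume bound: "\<And>F a. finite F \<Longrightarrow> (\<And>\<xi>. \<xi> \<notin> F \<Longrightarrow> a \<xi> = 0) \<Longrightarrow>
          cmod (\<Sum>\<xi>\<in>F. a \<xi> * b \<xi>) \<le> C * wlp_norm c 1 a"
    have "cmod (b \<xi>) * inverse (c \<xi>) \<le> C" for \<xi>
    proof -
      let ?e = "\<lambda>\<eta>. if \<eta> = \<xi> then 1 else 0 :: complex"
      have "wlp_norm c 1 ?e = c \<xi>"
        using wlp_norm_finite(2)[of "{\<xi>}" ?e c 1] less_imp_le[OF c[of \<xi>]] by simp
      then show ?thesis
        using bound[of "{\<xi>}" ?e] c[of \<xi>] by (simp add: field_simps)
    qed
    then show "b \<in> ?Y \<and> ?M b \<le> C" by (auto simp: bdd_above_def intro!: cSUP_least)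
  qed (fact wlp_space_add[OF c zero_less_one] wlp_space_scale[OF zero_less_one] wlp_norm_finite(1)
      wlp_norm_tail[OF zero_less_one] M | simp add: wlp_norm_def)+
  show ?thesis by (rule dual_via_pairing)
qed

section \<open>Application to the spaces over the two systems\<close>

text \<open>Since \<open>(2 / p - 1) * p = 2 - p\<close>, the exponent \<open>2 / p - 1\<close>
  moves the outer weight inside the power.\<close>

lemma lp_eq_wlp:
  fixes Ninf :: "'h \<Rightarrow> real" and u v :: "'i \<Rightarrow> 'h"
  assumes p: "p \<ge> 1"
  defines "c \<equiv> \<lambda>\<xi>. Ninf (if p \<le> 2 then u \<xi> else v \<xi>) powr (2 / p - 1)"
  shows "lp_space Ninf u v (ennreal p) = wlp_space c p"
    and "lp_norm Ninf u v (ennreal p) = wlp_norm c p"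
proof -
  have *: "(c \<xi> * cmod (a \<xi>)) powr p = cmod (a \<xi>) powr p * Ninf (if p \<le> 2 then u \<xi> else v \<xi>) powr (2 - p)"
    for a \<xi>
  proof -
    have "(2 / p - 1) * p = 2 - p" using p by (simp add: field_simps)
    then show ?thesis by (simp add: c_def powr_mult powr_powr)
  qed
  have le2: "ennreal p \<le> 2 \<longleftrightarrow> p \<le> 2" using ennreal_le_iff[of 2 p] by simp
  show "lp_space Ninf u v (ennreal p) = wlp_space c p"
    using p by (cases "p \<le> 2") (simp_all add: lp_space_def wlp_space_def * le2)
  show "lp_norm Ninf u v (ennreal p) = wlp_norm c p"
    using p by (simp add: lp_norm_def wlp_norm_def * le2 fun_eq_iff)
qed

lemma dual_via_pairing_lp:
  assumes pos: "\<And>\<xi>. Ninf (u \<xi>) > (0::real)" "\<And>\<xi>. Ninf (v \<xi>) > 0"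
    and p: "1 \<le> p" "p < \<infinity>" and pq: "inverse p + inverse q = 1"
  shows "dual_via_pairing (lp_space Ninf u v p) (lp_norm Ninf u v p)
           (lp_space Ninf v u q) (lp_norm Ninf v u q)"
proof -
  obtain p' where p': "p = ennreal p'" "p' \<ge> 1"
    using p by (cases p) auto
  show ?thesis
  proof (cases "p' = 1")
    case True
    \<comment> \<open>The added 0 allows cancellation in \<open>ennreal\<close>; then
      \<open>inverse q = 0\<close> means that \<open>q\<close> is infinite.\<close>
    then have "1 + inverse q = 1 + 0" using pq p' by simp
    then have q: "q = \<infinity>" by (subst (asm) ennreal_add_left_cancel) simp
    have "lp_space Ninf u v p = wlp_space (\<lambda>\<xi>. Ninf (u \<xi>)) 1" "lp_norm Ninf u v p = wlp_norm (\<lambda>\<xi>. Ninf (u \<xi>)) 1"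
      using lp_eq_wlp[of 1 Ninf u v] p' True less_imp_le[OF pos(1)] by simp_all
    moreover have "lp_space Ninf v u q = {b. bdd_above (range (\<lambda>\<xi>. cmod (b \<xi>) * inverse (Ninf (u \<xi>))))}"
      "lp_norm Ninf v u q = (\<lambda>b. SUP \<xi>. cmod (b \<xi>) * inverse (Ninf (u \<xi>)))"
      by (simp_all add: lp_space_def lp_norm_def q fun_eq_iff)
    ultimately show ?thesis using dual_via_pairing_wl1[OF pos(1)] by simp
  next
    case False
    then have p1: "p' > 1" using p' by simp
    have "q \<noteq> \<infinity>"
      using pq p1 p' by (auto simp: inverse_ennreal)
    moreover have "q \<noteq> 0" using pq by auto
    ultimately obtain q' where q': "q = ennreal q'" "q' > 0" by (cases q) auto
    have "ennreal (inverse p' + inverse q') = ennreal 1"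
      using pq p1 p' q' by (simp add: inverse_ennreal flip: ennreal_plus)
    then have sum1: "1 / p' + 1 / q' = 1"
      using p1 q' by (subst (asm) ennreal_inj) (auto simp: inverse_eq_divide)
    then have "1 / q' < 1" using p1 by (smt (verit) zero_less_divide_iff)
    then have q1: "q' > 1" using q' by simp
    \<comment> \<open>Conjugate exponents lie on opposite sides of 2, so both definitions draw their
      weight from the same system.\<close>
    have le2: "q' \<le> 2 \<longleftrightarrow> 2 \<le> p'"
    proof -
      have "q' \<le> 2 \<longleftrightarrow> 1 / 2 \<le> 1 / q'" using q1 by (simp add: field_simps)
      also have "\<dots> \<longleftrightarrow> 1 / p' \<le> 1 / 2" using sum1 by linarith
      also have "\<dots> \<longleftrightarrow> 2 \<le> p'" using p1 by (simp add: field_simps)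
      finally show ?thesis .
    qed
    define c where "c = (\<lambda>\<xi>. Ninf (if p' \<le> 2 then u \<xi> else v \<xi>) powr (2 / p' - 1))"
    have c: "c \<xi> > 0" for \<xi> using pos[of \<xi>] by (simp add: c_def)
    have "(\<lambda>\<xi>. Ninf (if q' \<le> 2 then v \<xi> else u \<xi>) powr (2 / q' - 1)) = (\<lambda>\<xi>. inverse (c \<xi>))"
    proof
      fix \<xi>
      have exp: "2 / q' - 1 = - (2 / p' - 1)" using sum1 by simp
      show "Ninf (if q' \<le> 2 then v \<xi> else u \<xi>) powr (2 / q' - 1) = inverse (c \<xi>)"
      \<comment> \<open>At 2 the two case distinctions pick different systems, but the exponent is 0
        and both weights are 1. Positivity matters here because \<open>0 powr 0 = 0\<close>.\<close>
      proof (cases "p' = 2")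
        case True
        then show ?thesis
          unfolding exp c_def using pos(1)[of \<xi>] pos(2)[of \<xi>] by simp
      next
        case False
        then show ?thesis unfolding exp c_def le2 powr_minus by auto
      qed
    qed
    then have "lp_space Ninf v u q = wlp_space (\<lambda>\<xi>. inverse (c \<xi>)) q'"
      "lp_norm Ninf v u q = wlp_norm (\<lambda>\<xi>. inverse (c \<xi>)) q'"
      using lp_eq_wlp[of q' Ninf v u] q1 q' by simp_all
    moreover have "lp_space Ninf u v p = wlp_space c p'" "lp_norm Ninf u v p = wlp_norm c p'"
      using lp_eq_wlp[OF p'(2), of Ninf u v] p' by (simp_all add: c_def)
    ultimately show ?thesis using dual_via_pairing_wlp[OF c p1 q1 sum1] by simp
  qed
qed

theorem theorem3p6:
  fixes H :: "ennreal \<Rightarrow> 'h::complex_hilbert_space set"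
    and nrm :: "ennreal \<Rightarrow> 'h \<Rightarrow> real"
    and u v :: "'i::countable \<Rightarrow> 'h"
    and p q :: ennreal
  assumes separable: "separable_space (euclidean :: 'h topology)"
    and riesz: "riesz_basis u"
    and biorth: "biorthogonal u v"
    and family: "Hp_family H nrm"
    and u_in: "\<And>r \<xi>. 1 \<le> r \<Longrightarrow> u \<xi> \<in> H r"
    and v_in: "\<And>r \<xi>. 1 \<le> r \<Longrightarrow> v \<xi> \<in> H r"
    and p: "1 \<le> p" "p < \<infinity>"
    and pq: "inverse p + inverse q = 1"
  shows "dual_via_pairing (lp_space (nrm \<infinity>) u v p) (lp_norm (nrm \<infinity>) u v p)
           (lp_space (nrm \<infinity>) v u q) (lp_norm (nrm \<infinity>) v u q)
       \<and> dual_via_pairing (lp_space (nrm \<infinity>) v u p) (lp_norm (nrm \<infinity>) v u p)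
           (lp_space (nrm \<infinity>) u v q) (lp_norm (nrm \<infinity>) u v q)"
proof -
  interpret Hp_family H nrm by (rule family)
  interpret Hinf: complex_banach_space scaleC "H \<infinity>" "nrm \<infinity>" by (rule banach) simp
  \<comment> \<open>Biorthogonality makes all \<open>u \<xi>\<close> and \<open>v \<xi>\<close>
    nonzero, so their norms in \<open>H \<infinity>\<close> are positive weights.\<close>
  have "cinner (u \<xi>) (v \<xi>) = 1" for \<xi> using biorth by (simp add: biorthogonal_def)
  moreover have "cinner 0 y = 0" "cinner y 0 = 0" for y :: 'h
    using cinner_add_left[of 0 0 y] cinner_commute[of y 0] by simp_all
  ultimately have "u \<xi> \<noteq> 0" "v \<xi> \<noteq> 0" for \<xi> by (metis zero_neq_one)+
  then have "nrm \<infinity> (u \<xi>) > 0" "nrm \<infinity> (v \<xi>) > 0" for \<xi>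
    using Hinf.N_nonneg Hinf.N_eq_0_iff u_in[of \<infinity> \<xi>] v_in[of \<infinity> \<xi>] by (simp_all add: less_le)
  \<comment> \<open>The second duality is the first with \<open>u\<close> and \<open>v\<close>
    exchanged.\<close>
  then show ?thesis using dual_via_pairing_lp p pq by blast
qed

end
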